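(* If, for some loopless digraph $\mathbf H$, the problem $\mathrm{PCSP}(\mathbf H,\mathbf G)$ is NP-hard for all loopless digraphs $\mathbf G$ such that $\mathbf H\to\mathbf G$, then $\mathrm{PCSP}(\mathbf K_3,\mathbf G)$ is NP-hard for all loopless digraphs $\mathbf G$ such that $\mathbf K_3\to\mathbf G$.
   Context: Digraphs are finite. $\mathbf K_3$ is the complete loopless graph on 3 vertices, viewed as the digraph with all 6 arcs between distinct vertices. A homomorphism $\mathbf H\to\mathbf G$ is a map $V(H)\to V(G)$ sending arcs to arcs. For digraphs $\mathbf H\to\mathbf G$, $\mathrm{PCSP}(\mathbf H,\mathbf G)$ is the promise decision problem: given a finite digraph $\mathbf I$ with either $\mathbf I\to\mathbf H$ or $\mathbf I\not\to\mathbf G$, output YES in the former case and NO in the latter. *)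

theory Defs
  imports "Graph_Theory.Pair_Digraph" "HOL-Computational_Algebra.Polynomial"
begin

section \<open>Digraphs and homomorphisms\<close>

text \<open>
  Finite digraphs (loops allowed) are captured by \<^locale>\<open>pair_fin_digraph\<close>, finite loopless
  digraphs by \<^locale>\<open>pair_digraph\<close>.
\<close>

definition is_hom :: "('a \<Rightarrow> 'b) \<Rightarrow> 'a pair_pre_digraph \<Rightarrow> 'b pair_pre_digraph \<Rightarrow> bool" where
  "is_hom h H G \<longleftrightarrow>
     (\<forall>v \<in> pverts H. h v \<in> pverts G) \<and> (\<forall>(u, v) \<in> parcs H. (h u, h v) \<in> parcs G)"

definition hom_to :: "'a pair_pre_digraph \<Rightarrow> 'b pair_pre_digraph \<Rightarrow> bool" (infix \<open>\<rightarrow>\<^sub>h\<close> 50) where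
  "H \<rightarrow>\<^sub>h G \<longleftrightarrow> (\<exists>h. is_hom h H G)"

definition K3 :: "nat pair_pre_digraph" where
  "K3 = \<lparr> pverts = {..<3}, parcs = {(u, v). u < 3 \<and> v < 3 \<and> u \<noteq> v} \<rparr>"


section \<open>Turing machines\<close>

text \<open>
  Deterministic machines with finitely many two-way infinite tapes over the alphabet
  consisting of the two bits and the blank symbol \<^const>\<open>None\<close>. A tape is represented relative
  to the head: cell \<open>0\<close> is the scanned cell.
\<close>

type_synonym sym = "bool option"
type_synonym tape = "int \<Rightarrow> sym"

datatype dir = Left | Stay | Right

fun offset :: "dir \<Rightarrow> int" where
  "offset Left = -1"
| "offset Stay = 0"
| "offset Right = 1"

definition act :: "sym \<times> dir \<Rightarrow> tape \<Rightarrow> tape" where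
  "act a T = (\<lambda>i. (T(0 := fst a)) (i + offset (snd a)))"

text \<open>
  The states are \<open>0, \<dots>, nstates M\<close>; state \<open>0\<close> is initial and \<open>nstates M\<close> is the halting state.
\<close>

record tm =
  ntapes :: nat
  nstates :: nat
  delta :: "nat \<Rightarrow> sym list \<Rightarrow> nat \<times> (sym \<times> dir) list"

definition is_tm :: "tm \<Rightarrow> bool" where
  "is_tm M \<longleftrightarrow> ntapes M \<ge> 1 \<and>
     (\<forall>q < nstates M. \<forall>rs. length rs = ntapes M \<longrightarrow>
        fst (delta M q rs) \<le> nstates M \<and> length (snd (delta M q rs)) = ntapes M)"

type_synonym config = "nat \<times> (nat \<Rightarrow> tape)"

definition step :: "tm \<Rightarrow> config \<Rightarrow> config" where
  "step M = (\<lambda>(q, Ts).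
     if q < nstates M then
       (let (q', as) = delta M q (map (\<lambda>i. Ts i 0) [0..<ntapes M])
        in (q', \<lambda>i. if i < ntapes M then act (as ! i) (Ts i) else Ts i))
     else (q, Ts))"

definition tape_of :: "bool list \<Rightarrow> tape" where
  "tape_of w = (\<lambda>i. if 0 \<le> i \<and> i < int (length w) then Some (w ! nat i) else None)"

definition init :: "bool list list \<Rightarrow> config" where
  "init ws = (0, \<lambda>i. if i < length ws then tape_of (ws ! i) else tape_of [])"

text \<open>
  Started with the words \<open>ws\<close> on its first tapes, \<open>M\<close> halts within \<open>t\<close> steps with output \<open>y\<close> on
  tape \<open>0\<close>. A halted configuration is a fixed point of \<^const>\<open>step\<close>.
\<close>

definition outputs_within :: "tm \<Rightarrow> bool list list \<Rightarrow> nat \<Rightarrow> bool list \<Rightarrow> bool" where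
  "outputs_within M ws t y \<longleftrightarrow>
     length ws \<le> ntapes M \<and>
     (\<exists>Ts. (step M ^^ t) (init ws) = (nstates M, Ts) \<and> Ts 0 = tape_of y)"


section \<open>Polynomial time and NP-hardness\<close>

definition polytime_computable :: "(bool list \<Rightarrow> bool list) \<Rightarrow> bool" where
  "polytime_computable f \<longleftrightarrow>
     (\<exists>M (p :: nat poly). is_tm M \<and>
        (\<forall>x. outputs_within M [x] (poly p (length x)) (f x)))"

definition polytime_decidable2 :: "(bool list \<Rightarrow> bool list \<Rightarrow> bool) \<Rightarrow> bool" where
  "polytime_decidable2 V \<longleftrightarrow>
     (\<exists>M (p :: nat poly). is_tm M \<and>
        (\<forall>x y. outputs_within M [x, y] (poly p (length x + length y)) [V x y]))"

definition in_NP :: "bool list set \<Rightarrow> bool" where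
  "in_NP L \<longleftrightarrow>
     (\<exists>V (q :: nat poly). polytime_decidable2 V \<and>
        (\<forall>x. x \<in> L \<longleftrightarrow> (\<exists>y. length y \<le> poly q (length x) \<and> V x y)))"

text \<open>
  A promise problem is the pair of its YES-instances and its NO-instances. Hardness is with respect
  to polynomial-time many-one reductions.
\<close>

type_synonym promise_problem = "bool list set \<times> bool list set"

definition reduces_to :: "bool list set \<Rightarrow> promise_problem \<Rightarrow> bool" where
  "reduces_to L P \<longleftrightarrow>
     (\<exists>f. polytime_computable f \<and>
        (\<forall>x. (x \<in> L \<longrightarrow> f x \<in> fst P) \<and> (x \<notin> L \<longrightarrow> f x \<in> snd P)))"

definition NP_hard :: "promise_problem \<Rightarrow> bool" where
  "NP_hard P \<longleftrightarrow> (\<forall>L. in_NP L \<longrightarrow> reduces_to L P)"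


section \<open>Promise constraint satisfaction problems\<close>

definition instance_digraph :: "nat pair_pre_digraph \<Rightarrow> bool" where
  "instance_digraph I \<longleftrightarrow> pair_fin_digraph I \<and> pverts I = {..<card (pverts I)}"

text \<open>The number of vertices in unary, a separator, and the adjacency matrix row by row.\<close>

definition encode :: "nat pair_pre_digraph \<Rightarrow> bool list" where
  "encode I = (let n = card (pverts I) in
     replicate n True @ [False] @ [(u, v) \<in> parcs I. u \<leftarrow> [0..<n], v \<leftarrow> [0..<n]])"

definition PCSP :: "'a pair_pre_digraph \<Rightarrow> 'b pair_pre_digraph \<Rightarrow> promise_problem" where
  "PCSP H G =
     ({encode I | I. instance_digraph I \<and> I \<rightarrow>\<^sub>h H},
      {encode I | I. instance_digraph I \<and> \<not> I \<rightarrow>\<^sub>h G})"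

end

theory Submission
  imports Defs
begin

text \<open>
  Let \<open>D\<close> denote the arc digraph construction: the vertices of \<open>D I\<close> are the arcs of \<open>I\<close>, and there is
  an arc from \<open>(u, v)\<close> to \<open>(v, w)\<close>. If \<open>I\<close> has a proper colouring with \<open>k + 1 \<ge> 4\<close> colours then
  \<open>D (D I)\<close> has one with \<open>k\<close> colours; hence \<open>D ^ (2 * m)\<close> maps all digraphs that admit a homomorphism
  to \<open>H\<close>, with \<open>m\<close> the number of vertices of \<open>H\<close>, to 3-colourable ones. Conversely, if \<open>D I\<close> is
  \<open>k\<close>-colourable then \<open>I\<close> is \<open>2 ^ k\<close>-colourable. So if \<open>D ^ (2 * m) I\<close> maps to the loopless digraph
  \<open>G\<close>, then \<open>I\<close> maps to a complete digraph \<open>G'\<close> depending only on \<open>G\<close> and \<open>m\<close>, and \<open>D ^ (2 * m)\<close> reduces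
  \<open>PCSP(H, G')\<close> to \<open>PCSP(K3, G)\<close>. That \<open>D\<close> is computable in polynomial time is shown with an explicit
  five-tape machine, compiled from a structured program.
\<close>

section \<open>Arc digraphs and colourings\<close>

definition complete_digraph :: "nat \<Rightarrow> nat pair_pre_digraph" where
  "complete_digraph k = \<lparr> pverts = {..<k}, parcs = {(u, v). u < k \<and> v < k \<and> u \<noteq> v} \<rparr>"

text \<open>
  The pair \<open>(u, v)\<close> of vertices of a digraph on \<open>{..<n}\<close> is coded by the number \<open>u * n + v\<close>.
  Pairs that are not arcs are kept as isolated vertices, which do not matter for homomorphisms into
  a digraph with at least one vertex.
\<close>

definition arc_digraph :: "nat pair_pre_digraph \<Rightarrow> nat pair_pre_digraph" where
  "arc_digraph I = (let n = card (pverts I) in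
     \<lparr> pverts = {..<n * n},
       parcs = {(p, q). p < n * n \<and> q < n * n \<and> p mod n = q div n \<and>
                  (p div n, p mod n) \<in> parcs I \<and> (q div n, q mod n) \<in> parcs I} \<rparr>)"

section \<open>Homomorphisms and complete digraphs\<close>

lemma hom_to_trans: "A \<rightarrow>\<^sub>h B \<Longrightarrow> B \<rightarrow>\<^sub>h C \<Longrightarrow> A \<rightarrow>\<^sub>h C"
  unfolding hom_to_def is_hom_def
proof (elim exE conjE)
  fix f g
  assume "\<forall>v\<in>pverts A. f v \<in> pverts B" "\<forall>(u, v)\<in>parcs A. (f u, f v) \<in> parcs B"
    "\<forall>v\<in>pverts B. g v \<in> pverts C" "\<forall>(u, v)\<in>parcs B. (g u, g v) \<in> parcs C"
  then show "\<exists>h. (\<forall>v\<in>pverts A. h v \<in> pverts C) \<and> (\<forall>(u, v)\<in>parcs A. (h u, h v) \<in> parcs C)"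
    by (intro exI[of _ "g \<circ> f"]) fastforce
qed

lemma K3_eq_complete_digraph: "K3 = complete_digraph 3"
  by (simp add: K3_def complete_digraph_def)

lemma pair_digraph_complete_digraph: "pair_digraph (complete_digraph k)"
proof -
  have "parcs (complete_digraph k) \<subseteq> {..<k} \<times> {..<k}"
    by (auto simp: complete_digraph_def)
  then have "finite (parcs (complete_digraph k))"
    by (rule finite_subset) simp
  then show ?thesis
    by unfold_locales (auto simp: complete_digraph_def)
qed

lemma complete_digraph_mono: "k \<le> l \<Longrightarrow> complete_digraph k \<rightarrow>\<^sub>h complete_digraph l"
  unfolding hom_to_def is_hom_def complete_digraph_def by (intro exI[of _ id]) auto

text \<open>Numbering the vertices is a proper colouring, since without loops the two ends of an arc
  get different numbers.\<close>

lemma hom_to_complete_digraph: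
  assumes "pair_digraph G"
  shows "G \<rightarrow>\<^sub>h complete_digraph (card (pverts G))"
proof -
  interpret pair_digraph G by fact
  obtain h where "bij_betw h (pverts G) {0..<card (pverts G)}"
    using ex_bij_betw_finite_nat[of "pverts G"] pair_finite_verts by blast
  then have h: "inj_on h (pverts G)" "\<And>v. v \<in> pverts G \<Longrightarrow> h v < card (pverts G)"
    by (auto simp: bij_betw_def)
  have "h u \<noteq> h v" if "(u, v) \<in> parcs G" for u v
    using that h(1) no_loops' in_arcsD1 in_arcsD2 by (metis inj_onD)
  then show ?thesis
    unfolding hom_to_def is_hom_def complete_digraph_def
    using h in_arcsD1 in_arcsD2 by (intro exI[of _ h]) auto
qed

section \<open>Vertices and arcs of the arc digraph\<close>

lemma arc_digraph_verts: "pverts (arc_digraph I) = {..<card (pverts I) * card (pverts I)}"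
  by (simp add: arc_digraph_def Let_def)

lemma instance_arc_digraph: "instance_digraph (arc_digraph I)"
proof -
  let ?V = "{..<card (pverts I) * card (pverts I)}"
  have "parcs (arc_digraph I) \<subseteq> ?V \<times> ?V"
    by (auto simp: arc_digraph_def Let_def)
  then have "finite (parcs (arc_digraph I))"
    by (rule finite_subset) simp
  then have "pair_fin_digraph (arc_digraph I)"
    by unfold_locales (auto simp: arc_digraph_def Let_def)
  then show ?thesis
    by (simp add: instance_digraph_def arc_digraph_verts)
qed

lemma instance_arcD:
  assumes "instance_digraph I" "(u, v) \<in> parcs I"
  shows "u < card (pverts I)" "v < card (pverts I)"
proof -
  interpret pair_fin_digraph I using assms(1) by (simp add: instance_digraph_def)
  have "pverts I = {..<card (pverts I)}" using assms(1) by (simp add: instance_digraph_def)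
  then show "u < card (pverts I)" "v < card (pverts I)"
    using in_arcsD1[OF assms(2)] in_arcsD2[OF assms(2)] by auto
qed

lemma pair_code_less:
  fixes u v n :: nat
  assumes "u < n" "v < n"
  shows "u * n + v < n * n"
proof -
  have "u * n + v < Suc u * n" using assms by simp
  also have "\<dots> \<le> n * n" using assms by (intro mult_le_mono) auto
  finally show ?thesis .
qed

lemma arc_digraph_arcI:
  assumes "instance_digraph I" "(u, v) \<in> parcs I" "(v, w) \<in> parcs I"
  shows "(u * card (pverts I) + v, v * card (pverts I) + w) \<in> parcs (arc_digraph I)"
proof -
  let ?n = "card (pverts I)"
  have "u < ?n" "v < ?n" "w < ?n"
    using instance_arcD assms by blast+
  then show ?thesis
    using assms by (simp add: arc_digraph_def Let_def pair_code_less)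
qed

text \<open>A vertex of \<open>I\<close> gets the set of colours of its outgoing arcs.\<close>

lemma arc_digraph_colouring_lift:
  assumes I: "instance_digraph I" and "arc_digraph I \<rightarrow>\<^sub>h complete_digraph k"
  shows "I \<rightarrow>\<^sub>h complete_digraph (2 ^ k)"
proof -
  let ?n = "card (pverts I)"
  obtain c where c: "is_hom c (arc_digraph I) (complete_digraph k)"
    using assms(2) by (auto simp: hom_to_def)
  obtain e where "bij_betw e (Pow {..<k}) {0..<card (Pow {..<k})}"
    using ex_bij_betw_finite_nat[of "Pow {..<k}"] by auto
  then have e: "inj_on e (Pow {..<k})" "\<And>A. A \<in> Pow {..<k} \<Longrightarrow> e A < 2 ^ k"
    by (auto simp: bij_betw_def card_Pow)
  \<comment> \<open>Cutting down to \<open>{..<k}\<close> puts \<open>S u\<close> into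
    \<open>Pow {..<k}\<close> for every \<open>u\<close>; no colour of an arc is lost, because
    \<open>c\<close> stays below \<open>k\<close> on all coded pairs.\<close>
  define S where "S u = {c (u * ?n + v) | v. (u, v) \<in> parcs I} \<inter> {..<k}" for u
  have S: "S u \<in> Pow {..<k}" for u
    by (auto simp: S_def)
  have "S u \<noteq> S v" if uv: "(u, v) \<in> parcs I" for u v
  proof
    assume eq: "S u = S v"
    have "u * ?n + v < ?n * ?n"
      using pair_code_less[OF instance_arcD[OF I uv]] .
    then have "c (u * ?n + v) < k"
      using c by (auto simp: is_hom_def arc_digraph_verts complete_digraph_def)
    then have "c (u * ?n + v) \<in> S u"
      using uv by (auto simp: S_def)
    \<comment> \<open>\<open>S v\<close> contains the colour of the arc \<open>(u, v)\<close>, so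
      some arc \<open>(v, w)\<close> shares it, although the two arcs are adjacent in the arc
      digraph.\<close>
    then obtain w where w: "(v, w) \<in> parcs I" "c (u * ?n + v) = c (v * ?n + w)"
      unfolding eq by (auto simp: S_def)
    show False
      using c arc_digraph_arcI[OF I uv w(1)] w(2) by (auto simp: is_hom_def complete_digraph_def)
  qed
  then have "e (S u) \<noteq> e (S v)" if "(u, v) \<in> parcs I" for u v
    using that e(1) S by (meson inj_onD)
  then have "is_hom (\<lambda>u. e (S u)) I (complete_digraph (2 ^ k))"
    using e(2) S by (auto simp: is_hom_def complete_digraph_def)
  then show ?thesis
    by (auto simp: hom_to_def)
qed

text \<open>
  Vertices of the twice iterated arc digraph are walks \<open>a, b, c\<close>. Such a walk inherits the colour
  of \<open>b\<close>, except that the colour \<open>k\<close> is replaced by any smaller colour different from those of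
  \<open>a\<close> and \<open>c\<close>; this needs at least three smaller colours.
\<close>

lemma arc_digraph_colouring_drop:
  assumes I: "instance_digraph I" and "I \<rightarrow>\<^sub>h complete_digraph (Suc k)" and k: "3 \<le> k"
  shows "arc_digraph (arc_digraph I) \<rightarrow>\<^sub>h complete_digraph k"
proof -
  let ?n = "card (pverts I)"
  obtain c where c: "is_hom c I (complete_digraph (Suc k))"
    using assms(2) by (auto simp: hom_to_def)
  have ck: "c u < Suc k" "c v < Suc k" "c u \<noteq> c v" if "(u, v) \<in> parcs I" for u v
    using c that by (auto simp: is_hom_def complete_digraph_def)
  define free where "free x y = (SOME z. z < k \<and> z \<noteq> x \<and> z \<noteq> y)" for x y :: nat
  have free: "free x y < k" "free x y \<noteq> x" "free x y \<noteq> y" for x y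
  proof -
    have "\<exists>z<3. z \<noteq> x \<and> z \<noteq> (y::nat)"
      by presburger
    then have "\<exists>z. z < k \<and> z \<noteq> x \<and> z \<noteq> y"
      using k by (meson less_le_trans)
    from someI_ex[OF this] show "free x y < k" "free x y \<noteq> x" "free x y \<noteq> y"
      by (auto simp: free_def)
  qed
  define col where "col x y z = (if c y < k then c y else free (c x) (c z))" for x y z
  \<comment> \<open>\<open>P\<close> codes a pair \<open>p\<close>, \<open>q\<close> of codes of
    pairs. If these are consecutive arcs, the walk visits \<open>p div ?n\<close>,
    \<open>p mod ?n\<close> and \<open>q mod ?n\<close>.\<close>
  define walk_col where "walk_col P =
    (let p = P div (?n * ?n); q = P mod (?n * ?n) in col (p div ?n) (p mod ?n) (q mod ?n))" for P
  have "walk_col P < k" for P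
    by (simp add: walk_col_def col_def Let_def free)
  moreover have "walk_col P \<noteq> walk_col Q"
    if PQ: "(P, Q) \<in> parcs (arc_digraph (arc_digraph I))" for P Q
  proof -
    let ?m = "?n * ?n"
    define p q r where "p = P div ?m" and "q = P mod ?m" and "r = Q mod ?m"
    have "Q div ?m = q" and pq: "(p, q) \<in> parcs (arc_digraph I)" and qr: "(q, r) \<in> parcs (arc_digraph I)"
      using PQ by (auto simp: arc_digraph_def[of "arc_digraph I"] arc_digraph_verts Let_def
          p_def q_def r_def)
    have col: "walk_col P = col (p div ?n) (p mod ?n) (q mod ?n)"
      "walk_col Q = col (p mod ?n) (q mod ?n) (r mod ?n)"
      using pq qr \<open>Q div ?m = q\<close>
      by (auto simp: walk_col_def Let_def p_def q_def r_def arc_digraph_def)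
    have "(p div ?n, p mod ?n) \<in> parcs I" "(p mod ?n, q mod ?n) \<in> parcs I"
      "(q mod ?n, r mod ?n) \<in> parcs I"
      using pq qr by (auto simp: arc_digraph_def Let_def)
    \<comment> \<open>The middle vertices of the two walks are adjacent, so at most one of them has
      colour \<open>k\<close>. Its replacement avoids the colour of the other one, which is an end
      of its walk.\<close>
    from this[THEN ck(1)] this[THEN ck(2)] this[THEN ck(3)]
      free(2)[of "c (p mod ?n)" "c (r mod ?n)"] free(3)[of "c (p div ?n)" "c (q mod ?n)"]
    show ?thesis
      unfolding col col_def by (simp split: if_split)
  qed
  ultimately have "is_hom walk_col (arc_digraph (arc_digraph I)) (complete_digraph k)"
    by (auto simp: is_hom_def complete_digraph_def)
  then show ?thesis
    by (auto simp: hom_to_def)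
qed

lemma instance_arc_digraph_iterate:
  "instance_digraph I \<Longrightarrow> instance_digraph ((arc_digraph ^^ i) I)"
  by (cases i) (auto simp: instance_arc_digraph)

text \<open>Two applications of the construction save one colour as long as more than three are
  left, so \<open>m\<close> rounds remove \<open>m\<close> colours.\<close>

lemma iterated_arc_digraph_3_colouring:
  assumes "instance_digraph I" "I \<rightarrow>\<^sub>h complete_digraph (3 + m)"
  shows "(arc_digraph ^^ (2 * m)) I \<rightarrow>\<^sub>h K3"
  using assms
proof (induction m arbitrary: I)
  case 0
  then show ?case by (simp add: K3_eq_complete_digraph)
next
  case (Suc m)
  have "arc_digraph (arc_digraph I) \<rightarrow>\<^sub>h complete_digraph (3 + m)"
    using Suc.prems by (intro arc_digraph_colouring_drop) auto
  then have "(arc_digraph ^^ (2 * m)) (arc_digraph (arc_digraph I)) \<rightarrow>\<^sub>h K3"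
    using Suc.IH instance_arc_digraph by blast
  moreover have "2 * Suc m = Suc (Suc (2 * m))" by simp
  ultimately show ?case by (simp only: funpow_Suc_right o_apply)
qed

text \<open>Each application costs one exponential, so a tower of \<open>i\<close> twos topped by
  \<open>k\<close> serves as \<open>K\<close>. It is quantified before \<open>I\<close> because the
  reduction fixes its target before it sees an instance.\<close>

lemma iterated_arc_digraph_colouring_lift:
  "\<exists>K. \<forall>I. instance_digraph I \<longrightarrow> (arc_digraph ^^ i) I \<rightarrow>\<^sub>h complete_digraph k
     \<longrightarrow> I \<rightarrow>\<^sub>h complete_digraph K"
proof (induction i)
  case 0
  then show ?case by auto
next
  case (Suc i)
  then obtain K where K: "\<And>I. instance_digraph I \<Longrightarrow> (arc_digraph ^^ i) I \<rightarrow>\<^sub>h complete_digraph k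
     \<Longrightarrow> I \<rightarrow>\<^sub>h complete_digraph K"
    by blast
  have "I \<rightarrow>\<^sub>h complete_digraph (2 ^ K)"
    if "instance_digraph I" "(arc_digraph ^^ Suc i) I \<rightarrow>\<^sub>h complete_digraph k" for I
    using that K[OF instance_arc_digraph, of I] arc_digraph_colouring_lift
    by (simp add: funpow_swap1)
  then show ?case by blast
qed

section \<open>Sequential composition of Turing machines\<close>

text \<open>This is how a tape is left alone: a transition writes on every tape, so it rewrites the
  scanned symbol and stays.\<close>

lemma act_Stay: "act (T 0, Stay) T = T"
  by (auto simp: act_def fun_eq_iff)

lemma step_halted: "nstates M \<le> q \<Longrightarrow> step M (q, Ts) = (q, Ts)"
  by (simp add: step_def)

lemma outputs_within_mono:
  assumes "outputs_within M ws t y" "t \<le> t'"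
  shows "outputs_within M ws t' y"
proof -
  obtain Ts where Ts: "(step M ^^ t) (init ws) = (nstates M, Ts)" "Ts 0 = tape_of y"
    using assms(1) by (auto simp: outputs_within_def)
  have "(step M ^^ (d + t)) (init ws) = (nstates M, Ts)" for d
    by (induction d) (simp_all add: Ts step_halted)
  from this[of "t' - t"] show ?thesis
    using assms Ts(2) by (auto simp: outputs_within_def)
qed

section \<open>Bounding the length of outputs by counting nonblank cells\<close>

definition nonblank :: "tape \<Rightarrow> int set" where
  "nonblank T = {i. T i \<noteq> None}"

text \<open>The move only renumbers cells, so the sole cell that can become nonblank is the one
  written.\<close>

lemma nonblank_act:
  assumes "finite (nonblank T)"
  shows "finite (nonblank (act a T))" "card (nonblank (act a T)) \<le> Suc (card (nonblank T))"
proof -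
  have sub: "nonblank (act a T) \<subseteq> (\<lambda>i. i - offset (snd a)) ` insert 0 (nonblank T)"
  proof
    fix i assume "i \<in> nonblank (act a T)"
    then have "i + offset (snd a) \<in> insert 0 (nonblank T)"
      by (auto simp: nonblank_def act_def split: if_splits)
    then show "i \<in> (\<lambda>i. i - offset (snd a)) ` insert 0 (nonblank T)"
      by (metis add_diff_cancel_right' imageI)
  qed
  then show "finite (nonblank (act a T))"
    using assms by (meson finite_imageI finite_insert finite_subset)
  have "card (nonblank (act a T)) \<le> card (insert 0 (nonblank T))"
    using sub assms by (meson card_image_le card_mono finite_imageI finite_insert le_trans)
  also have "\<dots> \<le> Suc (card (nonblank T))"
    by (rule card_insert_le_m1) simp_all
  finally show "card (nonblank (act a T)) \<le> Suc (card (nonblank T))" .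
qed

lemma nonblank_steps:
  assumes "finite (nonblank (snd c 0))"
  shows "finite (nonblank (snd ((step M ^^ t) c) 0)) \<and>
    card (nonblank (snd ((step M ^^ t) c) 0)) \<le> t + card (nonblank (snd c 0))"
proof (induction t)
  case 0
  then show ?case using assms by simp
next
  case (Suc t)
  obtain q Ts where eq: "(step M ^^ t) c = (q, Ts)" by force
  have "snd (step M (q, Ts)) 0 = Ts 0 \<or> (\<exists>a. snd (step M (q, Ts)) 0 = act a (Ts 0))"
    by (simp add: step_def Let_def split: prod.split) (metis surj_pair)
  moreover have "finite (nonblank (Ts 0))" "card (nonblank (Ts 0)) \<le> t + card (nonblank (snd c 0))"
    using Suc by (simp_all add: eq)
  ultimately show ?case
  proof (elim disjE exE)
    fix a assume "snd (step M (q, Ts)) 0 = act a (Ts 0)"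
    then show ?thesis
      using nonblank_act[OF \<open>finite (nonblank (Ts 0))\<close>, of a]
        \<open>card (nonblank (Ts 0)) \<le> t + card (nonblank (snd c 0))\<close> by (simp add: eq)
  qed (simp add: eq)
qed

lemma nonblank_tape_of: "nonblank (tape_of w) = int ` {..<length w}"
  by (force simp: nonblank_def tape_of_def image_iff Bex_def split: if_splits
      intro: exI[of _ "nat i" for i])

text \<open>Each step makes at most one more cell of tape \<open>0\<close> nonblank. This bounds the
  input that a second machine receives, and hence its running time.\<close>

lemma output_length:
  assumes "outputs_within M [x] t y"
  shows "length y \<le> t + length x"
proof -
  obtain Ts where Ts: "(step M ^^ t) (init [x]) = (nstates M, Ts)" "Ts 0 = tape_of y"
    using assms by (auto simp: outputs_within_def)
  have "card (nonblank (tape_of w)) = length w" for w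
    by (simp add: nonblank_tape_of card_image)
  then show ?thesis
    using nonblank_steps[where c = "init [x]" and M = M and t = t] Ts by (simp add: init_def nonblank_tape_of)
qed

text \<open>
  The second machine works on tape \<open>0\<close>, which holds the output of the first one, and otherwise on
  fresh tapes. The halting state of the first machine is the initial state of the second one.
\<close>

definition comp_tape :: "tm \<Rightarrow> nat \<Rightarrow> nat" where
  "comp_tape M j = (if j = 0 then 0 else ntapes M + j)"

definition comp_tm :: "tm \<Rightarrow> tm \<Rightarrow> tm" where
  "comp_tm M N = \<lparr> ntapes = ntapes M + ntapes N, nstates = nstates M + nstates N,
     delta = (\<lambda>q rs.
       if q < nstates M then
         (let (q', as) = delta M q (take (ntapes M) rs)
          in (q', as @ map (\<lambda>s. (s, Stay)) (drop (ntapes M) rs)))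
       else
         (let (q', as) = delta N (q - nstates M) (map (\<lambda>j. rs ! comp_tape M j) [0..<ntapes N])
          in (nstates M + q', map (\<lambda>i. if i = 0 then as ! 0
                else if i \<le> ntapes M then (rs ! i, Stay)
                else as ! (i - ntapes M)) [0..<ntapes M + ntapes N]))) \<rparr>"

lemma is_tm_comp:
  assumes "is_tm M" "is_tm N"
  shows "is_tm (comp_tm M N)"
  unfolding is_tm_def
proof (intro conjI allI impI)
  show "1 \<le> ntapes (comp_tm M N)"
    using assms by (auto simp: is_tm_def comp_tm_def)
  fix q and rs :: "sym list"
  assume q: "q < nstates (comp_tm M N)" and rs: "length rs = ntapes (comp_tm M N)"
  let ?rs = "take (ntapes M) rs"
  let ?rs' = "map (\<lambda>j. rs ! comp_tape M j) [0..<ntapes N]"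
  have "fst (delta M q ?rs) \<le> nstates M" "length (snd (delta M q ?rs)) = ntapes M"
    if "q < nstates M"
    using assms(1) rs that by (auto simp: is_tm_def comp_tm_def)
  moreover have "fst (delta N (q - nstates M) ?rs') \<le> nstates N" if "\<not> q < nstates M"
  proof -
    have "q - nstates M < nstates N" using q that by (auto simp: comp_tm_def)
    then show ?thesis using assms(2) by (auto simp: is_tm_def)
  qed
  ultimately show "fst (delta (comp_tm M N) q rs) \<le> nstates (comp_tm M N)"
    and "length (snd (delta (comp_tm M N) q rs)) = ntapes (comp_tm M N)"
    using rs by (auto simp: comp_tm_def case_prod_beta)
qed

lemma step_comp_first:
  assumes "is_tm M" "q < nstates M"
  shows "step (comp_tm M N) (q, Ts) = step M (q, Ts)"
proof -
  let ?rs = "map (\<lambda>i. Ts i 0) [0..<ntapes M]"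
  have "[0..<ntapes M + ntapes N] = [0..<ntapes M] @ [ntapes M..<ntapes M + ntapes N]"
    by (metis le_add1 le_add_same_cancel1 upt_add_eq_append)
  then have rs: "take (ntapes M) (map (\<lambda>i. Ts i 0) [0..<ntapes M + ntapes N]) = ?rs"
    "drop (ntapes M) (map (\<lambda>i. Ts i 0) [0..<ntapes M + ntapes N])
      = map (\<lambda>i. Ts i 0) [ntapes M..<ntapes M + ntapes N]"
    by (simp_all add: take_map drop_map)
  obtain q' as where d: "delta M q ?rs = (q', as)" by force
  then have "length as = ntapes M"
    using assms by (auto simp: is_tm_def dest!: spec[of _ q] spec[of _ ?rs])
  then show ?thesis
    using assms(2) d unfolding step_def
    by (auto simp: comp_tm_def Let_def rs nth_append act_Stay fun_eq_iff simp del: upt_Suc)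
qed

text \<open>After \<open>M\<close> has halted, the composed machine goes on with \<open>N\<close>,
  so only the steps before halting are mirrored; \<open>t'\<close> counts these.\<close>

lemma steps_comp_first:
  assumes "is_tm M"
  shows "\<exists>t'\<le>t. (step (comp_tm M N) ^^ t') c = (step M ^^ t) c"
proof (induction t)
  case 0
  then show ?case by simp
next
  case (Suc t)
  then obtain t' where t': "t' \<le> t" "(step (comp_tm M N) ^^ t') c = (step M ^^ t) c" by blast
  obtain q Ts where eq: "(step M ^^ t) c = (q, Ts)" by force
  show ?case
  proof (cases "q < nstates M")
    case True
    then show ?thesis
      using t' eq step_comp_first[OF assms] by (intro exI[of _ "Suc t'"]) simp
  next
    case False
    then show ?thesis
      using t' eq by (intro exI[of _ t']) (simp add: step_halted)
  qed
qed

text \<open>The invariant speaks of the tapes assigned to \<open>N\<close> only; the others may hold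
  whatever \<open>M\<close> has left there.\<close>

lemma step_comp_second:
  assumes "is_tm M" "is_tm N" and R: "\<forall>j<ntapes N. Us (comp_tape M j) = Ts j"
    and st: "step N (q, Ts) = (q', Ts')"
  shows "\<exists>Us'. step (comp_tm M N) (nstates M + q, Us) = (nstates M + q', Us') \<and>
    (\<forall>j<ntapes N. Us' (comp_tape M j) = Ts' j)"
proof (cases "q < nstates N")
  case False
  then show ?thesis
    using st R by (auto simp: step_halted comp_tm_def)
next
  case True
  let ?rs = "map (\<lambda>i. Us i 0) [0..<ntapes M + ntapes N]"
  have pos: "0 < ntapes M" "0 < ntapes N" using assms by (auto simp: is_tm_def)
  have rs: "map (\<lambda>j. ?rs ! comp_tape M j) [0..<ntapes N] = map (\<lambda>i. Ts i 0) [0..<ntapes N]"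
    using R pos by (auto simp: comp_tape_def)
  obtain as where d: "delta N q (map (\<lambda>i. Ts i 0) [0..<ntapes N]) = (q', as)"
    and Ts': "Ts' = (\<lambda>i. if i < ntapes N then act (as ! i) (Ts i) else Ts i)"
    using st True by (auto simp: step_def Let_def split: prod.splits)
  have "step (comp_tm M N) (nstates M + q, Us) = (nstates M + q',
     \<lambda>i. if i < ntapes M + ntapes N then
        act (if i = 0 then as ! 0 else if i \<le> ntapes M then (Us i 0, Stay)
             else as ! (i - ntapes M)) (Us i) else Us i)"
    using True unfolding step_def
    by (auto simp: comp_tm_def Let_def rs d fun_eq_iff simp del: upt_Suc)
  then show ?thesis
    using R pos by (auto simp: Ts' comp_tape_def)
qed

lemma steps_comp_second:
  assumes "is_tm M" "is_tm N" "\<forall>j<ntapes N. Us (comp_tape M j) = Ts j"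
    and "(step N ^^ t) (q, Ts) = (q', Ts')"
  shows "\<exists>Us'. (step (comp_tm M N) ^^ t) (nstates M + q, Us) = (nstates M + q', Us') \<and>
    (\<forall>j<ntapes N. Us' (comp_tape M j) = Ts' j)"
  using assms(4)
proof (induction t arbitrary: q' Ts')
  case 0
  then show ?case using assms(3) by auto
next
  case (Suc t)
  obtain q1 Ts1 where eq: "(step N ^^ t) (q, Ts) = (q1, Ts1)" by force
  then obtain Us1 where Us1: "(step (comp_tm M N) ^^ t) (nstates M + q, Us) = (nstates M + q1, Us1)"
    "\<forall>j<ntapes N. Us1 (comp_tape M j) = Ts1 j"
    using Suc.IH by blast
  have "step N (q1, Ts1) = (q', Ts')"
    using Suc.prems eq by simp
  from step_comp_second[OF assms(1,2) Us1(2) this] show ?case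
    using Us1(1) by simp
qed

text \<open>Guarantees that the fresh tapes of the second machine are still blank when it
  starts.\<close>

lemma steps_untouched:
  assumes "ntapes M \<le> i"
  shows "snd ((step M ^^ t) c) i = snd c i"
proof (induction t)
  case (Suc t)
  obtain q Ts where eq: "(step M ^^ t) c = (q, Ts)" by force
  have "snd (step M (q, Ts)) i = Ts i"
    using assms by (auto simp: step_def Let_def split: prod.split)
  then show ?case using Suc by (simp add: eq)
qed simp

lemma outputs_within_comp:
  assumes M: "is_tm M" and N: "is_tm N"
    and f: "outputs_within M [x] s y" and g: "outputs_within N [y] t z"
  shows "outputs_within (comp_tm M N) [x] (s + t) z"
proof -
  obtain Ts where Ts: "(step M ^^ s) (init [x]) = (nstates M, Ts)" "Ts 0 = tape_of y"
    using f by (auto simp: outputs_within_def)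
  obtain Ts' where Ts': "(step N ^^ t) (init [y]) = (nstates N, Ts')" "Ts' 0 = tape_of z"
    using g by (auto simp: outputs_within_def)
  obtain s' where s': "s' \<le> s" "(step (comp_tm M N) ^^ s') (init [x]) = (nstates M, Ts)"
    using steps_comp_first[OF M, of s N "init [x]"] Ts(1) by auto
  have pos: "0 < ntapes M" "0 < ntapes N"
    using M N by (auto simp: is_tm_def)
  have "Ts i = tape_of []" if "ntapes M \<le> i" for i
    using steps_untouched[OF that, of s "init [x]"] pos that unfolding Ts(1) by (simp add: init_def)
  \<comment> \<open>Tapes are relative to the head, so \<open>Ts 0 = tape_of y\<close> also says
    that the head scans the first symbol of \<open>y\<close>, just as \<open>N\<close>
    expects.\<close>
  then have "\<forall>j<ntapes N. Ts (comp_tape M j) = snd (init [y]) j"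
    by (auto simp: comp_tape_def init_def Ts)
  moreover have "(step N ^^ t) (0, snd (init [y])) = (nstates N, Ts')"
    using Ts'(1) by (simp add: init_def)
  ultimately obtain Us where Us: "(step (comp_tm M N) ^^ t) (nstates M, Ts) = (nstates M + nstates N, Us)"
    "\<forall>j<ntapes N. Us (comp_tape M j) = Ts' j"
    using steps_comp_second[OF M N, of Ts "snd (init [y])" t 0] by auto
  have "Us 0 = tape_of z"
    using Us(2) pos Ts'(2) by (auto simp: comp_tape_def)
  moreover have "(step (comp_tm M N) ^^ (t + s')) (init [x]) = (nstates M + nstates N, Us)"
    by (simp add: funpow_add s' Us)
  ultimately have "outputs_within (comp_tm M N) [x] (t + s') z"
    using pos by (simp add: outputs_within_def comp_tm_def)
  then show ?thesis
    using s'(1) by (elim outputs_within_mono) simp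
qed

lemma poly_nat_mono:
  fixes p :: "nat poly"
  shows "m \<le> n \<Longrightarrow> poly p m \<le> poly p n"
  by (induction p) (auto intro!: add_mono mult_mono)

text \<open>\<open>N\<close> is constrained on values of \<open>f\<close> only; this admits a
  machine that is correct just on encodings of digraphs.\<close>

theorem polytime_computable_comp:
  assumes "polytime_computable f"
    and N: "is_tm N" "\<And>x. outputs_within N [f x] (poly p (length (f x))) (g x)"
  shows "polytime_computable g"
proof -
  obtain M and r :: "nat poly" where M: "is_tm M" "\<And>x. outputs_within M [x] (poly r (length x)) (f x)"
    using assms(1) by (auto simp: polytime_computable_def)
  \<comment> \<open>\<open>[:0, 1:]\<close> is the identity, so the argument of \<open>p\<close> is
    the bound on the output length of \<open>M\<close>: running time plus input length.\<close>
  let ?s = "r + pcompose p (r + [:0, 1:])"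
  have "outputs_within (comp_tm M N) [x] (poly ?s (length x)) (g x)" for x
  proof -
    have "outputs_within (comp_tm M N) [x] (poly r (length x) + poly p (length (f x))) (g x)"
      using outputs_within_comp[OF M(1) N(1) M(2) N(2)] .
    moreover have "poly p (length (f x)) \<le> poly p (poly r (length x) + length x)"
      using output_length[OF M(2)] by (rule poly_nat_mono)
    ultimately show ?thesis
      by (elim outputs_within_mono) (simp add: poly_pcompose)
  qed
  then show ?thesis
    unfolding polytime_computable_def using is_tm_comp[OF M(1) N(1)] by blast
qed

section \<open>Structured programs\<close>

datatype prog =
    Act "sym list \<Rightarrow> (sym \<times> dir) list"
  | Seq prog prog (infixr \<open>;;\<close> 60)
  | While "sym list \<Rightarrow> bool" prog

abbreviation scan :: "tape list \<Rightarrow> sym list" where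
  "scan Ts \<equiv> map (\<lambda>T. T 0) Ts"

text \<open>The number is the exact count of machine steps: one for each action and one for each
  loop test, which has a state of its own.\<close>

inductive exec :: "prog \<Rightarrow> tape list \<Rightarrow> nat \<Rightarrow> tape list \<Rightarrow> bool" where
  exec_Act: "exec (Act f) Ts 1 (map2 act (f (scan Ts)) Ts)"
| exec_Seq: "exec p Ts t Ts' \<Longrightarrow> exec p' Ts' t' Ts'' \<Longrightarrow> exec (p ;; p') Ts (t + t') Ts''"
| exec_While_False: "\<not> b (scan Ts) \<Longrightarrow> exec (While b p) Ts 1 Ts"
| exec_While_True: "b (scan Ts) \<Longrightarrow> exec p Ts t Ts' \<Longrightarrow> exec (While b p) Ts' t' Ts''
    \<Longrightarrow> exec (While b p) Ts (Suc (t + t')) Ts''"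

text \<open>
  \<open>code p a e\<close> is the transition function of \<open>p\<close> on the states \<open>a, \<dots>, a + prog_size p - 1\<close>
  with entry \<open>a\<close> and exit \<open>e\<close>.
\<close>

fun prog_size :: "prog \<Rightarrow> nat" where
  "prog_size (Act f) = 1"
| "prog_size (p ;; p') = prog_size p + prog_size p'"
| "prog_size (While b p) = Suc (prog_size p)"

fun code :: "prog \<Rightarrow> nat \<Rightarrow> nat \<Rightarrow> nat \<Rightarrow> sym list \<Rightarrow> nat \<times> (sym \<times> dir) list" where
  "code (Act f) a e q rs = (e, f rs)"
| "code (p ;; p') a e q rs =
     (if q < a + prog_size p then code p a (a + prog_size p) q rs
      else code p' (a + prog_size p) e q rs)"
| "code (While b p) a e q rs =
     (if q = a then (if b rs then Suc a else e, map (\<lambda>s. (s, Stay)) rs)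
      else code p (Suc a) a q rs)"

fun prog_arity :: "nat \<Rightarrow> prog \<Rightarrow> bool" where
  "prog_arity k (Act f) \<longleftrightarrow> (\<forall>rs. length rs = k \<longrightarrow> length (f rs) = k)"
| "prog_arity k (p ;; p') \<longleftrightarrow> prog_arity k p \<and> prog_arity k p'"
| "prog_arity k (While b p) \<longleftrightarrow> prog_arity k p"

definition prog_tm :: "nat \<Rightarrow> prog \<Rightarrow> tm" where
  "prog_tm k p = \<lparr> ntapes = k, nstates = prog_size p, delta = code p 0 (prog_size p) \<rparr>"

lemma prog_size_pos: "0 < prog_size p"
  by (induction p) auto

lemma code_bounds:
  assumes "prog_arity k p" "length rs = k" "a \<le> q" "q < a + prog_size p"
    "a + prog_size p \<le> m" "e \<le> m"
  shows "fst (code p a e q rs) \<le> m" "length (snd (code p a e q rs)) = k"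
  using assms
proof (induction p arbitrary: a e)
  case (Seq p p')
  { case 1 then show ?case using Seq by auto }
  { case 2 then show ?case using Seq by auto }
next
  case (While b p)
  { case 1 then show ?case using While prog_size_pos[of p] by auto }
  { case 2 then show ?case using While by auto }
qed auto

lemma is_tm_prog:
  assumes "1 \<le> k" "prog_arity k p"
  shows "is_tm (prog_tm k p)"
  using assms(1) code_bounds[OF assms(2), of _ 0 _ "prog_size p" "prog_size p"]
  by (auto simp: is_tm_def prog_tm_def)

section \<open>Machines that execute compiled programs\<close>

definition tapes :: "tape list \<Rightarrow> nat \<Rightarrow> tape" where
  "tapes Ts i = (if i < length Ts then Ts ! i else tape_of [])"

lemma step_tapes:
  assumes "length Ts = ntapes M" "q < nstates M" "delta M q (scan Ts) = (q', as)"
    "length as = ntapes M"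
  shows "step M (q, tapes Ts) = (q', tapes (map2 act as Ts))"
proof -
  have "map (\<lambda>i. tapes Ts i 0) [0..<ntapes M] = scan Ts"
    using assms(1) by (auto simp: tapes_def intro!: nth_equalityI)
  then show ?thesis
    using assms by (auto simp: step_def tapes_def)
qed

lemma map2_act_Stay: "map2 act (map (\<lambda>s. (s, Stay)) (scan Ts)) Ts = Ts"
  by (induction Ts) (auto simp: act_Stay)

lemma length_exec: "exec p Ts t Ts' \<Longrightarrow> prog_arity (length Ts) p \<Longrightarrow> length Ts' = length Ts"
  by (induction rule: exec.induct) auto

text \<open>\<open>M\<close> has to agree with the code only on the block of states that belongs to
  \<open>p\<close>. So the induction can pass to subprograms, which are blocks inside the same
  machine.\<close>

lemma exec_steps:
  assumes "exec p Ts t Ts'" "prog_arity (ntapes M) p" "length Ts = ntapes M"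
    and "a + prog_size p \<le> nstates M"
    and "\<And>q rs. a \<le> q \<Longrightarrow> q < a + prog_size p \<Longrightarrow> length rs = ntapes M \<Longrightarrow>
      delta M q rs = code p a e q rs"
  shows "(step M ^^ t) (a, tapes Ts) = (e, tapes Ts')"
  using assms
proof (induction arbitrary: a e rule: exec.induct)
  case (exec_Act f Ts)
  then show ?case by (simp add: step_tapes)
next
  case (exec_Seq p Ts t Ts' p' t' Ts'')
  have "(step M ^^ t) (a, tapes Ts) = (a + prog_size p, tapes Ts')"
    using exec_Seq.prems by (intro exec_Seq.IH(1)) auto
  moreover have "(step M ^^ t') (a + prog_size p, tapes Ts') = (e, tapes Ts'')"
    using exec_Seq.prems length_exec[OF exec_Seq.hyps(1)] by (intro exec_Seq.IH(2)) auto
  ultimately show ?case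
    by (metis add.commute comp_apply funpow_add)
next
  case (exec_While_False b Ts p)
  then have "step M (a, tapes Ts) = (e, tapes (map2 act (map (\<lambda>s. (s, Stay)) (scan Ts)) Ts))"
    by (intro step_tapes) auto
  then show ?case
    by (simp only: map2_act_Stay One_nat_def funpow.simps o_apply id_apply)
next
  case (exec_While_True b Ts p t Ts' t' Ts'')
  have "step M (a, tapes Ts) = (Suc a, tapes (map2 act (map (\<lambda>s. (s, Stay)) (scan Ts)) Ts))"
    using exec_While_True.prems exec_While_True.hyps by (intro step_tapes) auto
  then have 1: "step M (a, tapes Ts) = (Suc a, tapes Ts)"
    by (simp only: map2_act_Stay)
  \<comment> \<open>The body is compiled with exit \<open>a\<close>, so it ends at the test of its
    own loop.\<close>
  have 2: "(step M ^^ t) (Suc a, tapes Ts) = (a, tapes Ts')"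
    using exec_While_True.prems by (intro exec_While_True.IH(1)) auto
  have "(step M ^^ t') (a, tapes Ts') = (e, tapes Ts'')"
    using exec_While_True.prems length_exec[OF exec_While_True.hyps(2)]
    by (intro exec_While_True.IH(2)) auto
  then have "(step M ^^ (t' + t)) (Suc a, tapes Ts) = (e, tapes Ts'')"
    by (simp add: funpow_add 2)
  then show ?case
    by (simp only: funpow_Suc_right o_apply 1 add.commute)
qed

section \<open>Upper bounds on the running time of programs\<close>

definition runs :: "prog \<Rightarrow> nat \<Rightarrow> tape list \<Rightarrow> tape list \<Rightarrow> bool" where
  "runs p t Ts Ts' \<longleftrightarrow> (\<exists>t'\<le>t. exec p Ts t' Ts')"

lemma prog_tm_outputs:
  assumes "prog_arity k p" "runs p t (tape_of x # replicate (k - 1) (tape_of [])) (tape_of y # Ts)"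
    and "1 \<le> k"
  shows "outputs_within (prog_tm k p) [x] t y"
proof -
  let ?Ts = "tape_of x # replicate (k - 1) (tape_of [])"
  obtain t' where t': "t' \<le> t" "exec p ?Ts t' (tape_of y # Ts)"
    using assms(2) by (auto simp: runs_def)
  have "init [x] = (0, tapes ?Ts)"
    by (auto simp: init_def tapes_def fun_eq_iff nth_Cons split: nat.split)
  moreover have "(step (prog_tm k p) ^^ t') (0, tapes ?Ts) = (prog_size p, tapes (tape_of y # Ts))"
    using assms(1,3) by (intro exec_steps[OF t'(2)]) (auto simp: prog_tm_def)
  ultimately have "outputs_within (prog_tm k p) [x] t' y"
    using assms(3) by (simp add: outputs_within_def prog_tm_def tapes_def)
  then show ?thesis
    using t'(1) by (rule outputs_within_mono)
qed

lemma runs_mono: "runs p t Ts Ts' \<Longrightarrow> t \<le> t' \<Longrightarrow> runs p t' Ts Ts'"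
  unfolding runs_def by (meson le_trans)

lemma runs_Act: "Ts' = map2 act (f (scan Ts)) Ts \<Longrightarrow> runs (Act f) 1 Ts Ts'"
  unfolding runs_def using exec_Act by blast

lemma runs_Seq: "runs p t Ts Ts' \<Longrightarrow> runs p' t' Ts' Ts'' \<Longrightarrow> runs (p ;; p') (t + t') Ts Ts''"
  unfolding runs_def by (meson add_mono exec_Seq)

text \<open>\<open>S i\<close> describes the tapes after \<open>i\<close> rounds. A round costs its
  test and at most \<open>t\<close> steps; the final \<open>+ 1\<close> is the failing test.\<close>

lemma runs_While:
  assumes "\<And>i. i < N \<Longrightarrow> b (scan (S i))" "\<And>i. i < N \<Longrightarrow> runs p t (S i) (S (Suc i))"
    and "\<not> b (scan (S N))"
  shows "runs (While b p) (N * Suc t + 1) (S 0) (S N)"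
proof -
  \<comment> \<open>Induction on the number \<open>m\<close> of rounds still to come.\<close>
  have "runs (While b p) (m * Suc t + 1) (S (N - m)) (S N)" if "m \<le> N" for m
    using that
  proof (induction m)
    case 0
    then show ?case
      using exec_While_False[of b "S N" p] assms(3) by (auto simp: runs_def)
  next
    case (Suc m)
    let ?i = "N - Suc m"
    have i: "?i < N" "Suc ?i = N - m" using Suc.prems by auto
    obtain t1 where t1: "t1 \<le> t" "exec p (S ?i) t1 (S (N - m))"
      using assms(2)[OF i(1)] i(2) by (auto simp: runs_def)
    obtain t2 where t2: "t2 \<le> m * Suc t + 1" "exec (While b p) (S (N - m)) t2 (S N)"
      using Suc by (auto simp: runs_def)
    show ?case
      unfolding runs_def
      using exec_While_True[of b, OF assms(1)[OF i(1)] t1(2) t2(2)] t1(1) t2(1)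
      by (intro exI[of _ "Suc (t1 + t2)"]) auto
  qed
  from this[of N] show ?thesis by simp
qed

section \<open>A program for the arc digraph\<close>

text \<open>The head position \<open>p\<close> is an integer because heads run past both ends of the
  word.\<close>

definition tape_at :: "bool list \<Rightarrow> int \<Rightarrow> tape" where
  "tape_at w p = (\<lambda>i. tape_of w (i + p))"

lemma tape_at_0: "tape_at w 0 = tape_of w"
  by (simp add: tape_at_def)

lemma tape_at_Nil: "tape_at [] p = tape_of []"
  by (auto simp: tape_at_def tape_of_def)

lemma read_tape_at: "tape_at w p 0 = (if 0 \<le> p \<and> p < int (length w) then Some (w ! nat p) else None)"
  by (auto simp: tape_at_def tape_of_def)

definition shift :: "int \<Rightarrow> tape \<Rightarrow> tape" where
  "shift k T = (\<lambda>i. T (i + k))"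

lemma shift_tape_at: "shift k (tape_at w p) = tape_at w (p + k)"
  by (simp add: shift_def tape_at_def algebra_simps)

lemma shift_blank: "shift k (tape_of []) = tape_of []"
  by (auto simp: shift_def tape_of_def fun_eq_iff)

lemma act_scanned: "act (T 0, d) T = shift (offset d) T"
  by (auto simp: act_def shift_def fun_eq_iff)

lemma act_move: "act (tape_at w p 0, d) (tape_at w p) = tape_at w (p + offset d)"
  by (simp add: act_scanned shift_tape_at)

lemma act_append:
  "act (Some b, d) (tape_at w (int (length w))) = tape_at (w @ [b]) (int (length w) + offset d)"
  by (auto simp: act_def tape_at_def tape_of_def fun_eq_iff nth_append algebra_simps)

lemma act_copy:
  assumes "k < length x"
  shows "act (tape_at x (int k) 0, d) (tape_at (take k x) (int k))
    = tape_at (take (Suc k) x) (int k + offset d)"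
  using act_append[of "x ! k" d "take k x"] assms
  by (simp add: read_tape_at take_Suc_conv_app_nth min_def)

lemma act_erase:
  assumes "k < length x"
  shows "act (None, d) (tape_at (take (Suc k) x) (int k)) = tape_at (take k x) (int k + offset d)"
  using assms
  by (auto simp: act_def tape_at_def tape_of_def fun_eq_iff nth_append take_Suc_conv_app_nth
      algebra_simps)

definition move :: "dir list \<Rightarrow> prog" where
  "move ds = Act (\<lambda>rs. zip rs ds)"

lemma runs_move:
  assumes "length ds = length Ts" "Ts' = map2 (\<lambda>d. shift (offset d)) ds Ts"
  shows "runs (move ds) 1 Ts Ts'"
proof -
  have "map2 act (zip (scan Ts) ds) Ts = map2 (\<lambda>d. shift (offset d)) ds Ts"
    using assms(1) by (induction ds Ts rule: list_induct2) (auto simp: act_scanned)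
  then show ?thesis
    unfolding move_def using assms(2) by (intro runs_Act) simp
qed

text \<open>For loops that only move heads the invariant can be computed: after \<open>j\<close>
  rounds each tape is shifted \<open>j\<close> times in its direction.\<close>

lemma runs_While_move:
  assumes "length ds = length Ts"
    and "\<And>j. j < N \<Longrightarrow> b (scan (map2 (\<lambda>d. shift (int j * offset d)) ds Ts))"
    and "\<not> b (scan (map2 (\<lambda>d. shift (int N * offset d)) ds Ts))"
    and "Ts' = map2 (\<lambda>d. shift (int N * offset d)) ds Ts"
  shows "runs (While b (move ds)) (2 * N + 1) Ts Ts'"
proof -
  let ?S = "\<lambda>j. map2 (\<lambda>d. shift (int j * offset d)) ds Ts"
  have "map2 (\<lambda>d. shift (offset d)) ds (?S j) = ?S (Suc j)" for j
    using assms(1)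
    by (induction ds Ts rule: list_induct2) (auto simp: shift_def algebra_simps)
  then have "runs (move ds) 1 (?S j) (?S (Suc j))" for j
    using assms(1) by (intro runs_move) simp_all
  then have "runs (While b (move ds)) (N * Suc 1 + 1) (?S 0) (?S N)"
    using assms by (intro runs_While)
  moreover have "?S 0 = Ts"
    using assms(1) by (induction ds Ts rule: list_induct2) (auto simp: shift_def)
  ultimately show ?thesis
    using assms(4) by (simp add: mult_2)
qed

text \<open>
  Tape \<open>0\<close> holds the input and finally the output. Tapes \<open>1\<close> and \<open>2\<close> are copies of the input, on
  which the row and column index of the output matrix are scanned; tapes \<open>3\<close> and \<open>4\<close> contain \<open>n\<close>
  in unary.
\<close>

definition copy_input :: prog where
  "copy_input =
     While (\<lambda>rs. rs ! 0 = Some True) (Act (\<lambda>rs. replicate 5 (rs ! 0, Right))) ;;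
     While (\<lambda>rs. rs ! 0 \<noteq> None) (Act (\<lambda>rs.
       [(rs ! 0, Right), (rs ! 0, Right), (rs ! 0, Right), (rs ! 3, Stay), (rs ! 4, Stay)])) ;;
     move [Left, Left, Left, Left, Left] ;;
     While (\<lambda>rs. rs ! 1 \<noteq> None) (Act (\<lambda>rs.
       [(None, Left), (rs ! 1, Left), (rs ! 2, Left), (rs ! 3, Stay), (rs ! 4, Stay)])) ;;
     While (\<lambda>rs. rs ! 3 \<noteq> None) (move [Stay, Stay, Stay, Left, Left]) ;;
     move [Stay, Right, Right, Right, Right]"

text \<open>The arc digraph has as many vertices as the input matrix has entries, so its unary
  header takes one \<open>True\<close> per entry passed on tape \<open>2\<close>. Finally tape
  \<open>2\<close> is rewound and tape \<open>1\<close> put on the first entry.\<close>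

definition write_header :: prog where
  "write_header =
     While (\<lambda>rs. rs ! 2 = Some True) (move [Stay, Stay, Right, Stay, Stay]) ;;
     move [Stay, Stay, Right, Stay, Stay] ;;
     While (\<lambda>rs. rs ! 2 \<noteq> None) (Act (\<lambda>rs.
       [(Some True, Right), (rs ! 1, Stay), (rs ! 2, Right), (rs ! 3, Stay), (rs ! 4, Stay)])) ;;
     Act (\<lambda>rs. [(Some False, Right), (rs ! 1, Stay), (rs ! 2, Left), (rs ! 3, Stay), (rs ! 4, Stay)]) ;;
     While (\<lambda>rs. rs ! 2 \<noteq> None) (move [Stay, Stay, Left, Stay, Stay]) ;;
     move [Stay, Stay, Right, Stay, Stay] ;;
     While (\<lambda>rs. rs ! 1 = Some True) (move [Stay, Right, Stay, Stay, Stay]) ;;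
     move [Stay, Right, Stay, Stay, Stay]"

text \<open>
  In the row of the pair \<open>(u, v)\<close>, the head of tape \<open>4\<close> starts at position \<open>- v * n\<close> and moves along
  with the column index, so that it scans a nonblank cell exactly for the columns \<open>(v, w)\<close>. Moving
  it back over the whole copy of the input leaves it at \<open>- (v + 1) * n\<close>, up to one step.
\<close>

definition write_row :: prog where
  "write_row =
     While (\<lambda>rs. rs ! 2 = Some True) (move [Stay, Stay, Right, Stay, Stay]) ;;
     move [Stay, Stay, Right, Stay, Stay] ;;
     While (\<lambda>rs. rs ! 2 \<noteq> None) (Act (\<lambda>rs.
       [(Some (rs ! 1 = Some True \<and> rs ! 2 = Some True \<and> rs ! 4 \<noteq> None), Right),
        (rs ! 1, Stay), (rs ! 2, Right), (rs ! 3, Stay), (rs ! 4, Right)])) ;;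
     move [Stay, Stay, Left, Stay, Stay] ;;
     While (\<lambda>rs. rs ! 2 \<noteq> None) (move [Stay, Stay, Left, Stay, Left]) ;;
     move [Stay, Right, Right, Right, Right]"

text \<open>A round of the outer loop treats all pairs \<open>(u, v)\<close> with the same
  \<open>u\<close>: tape \<open>3\<close> counts \<open>v\<close>, and tape \<open>1\<close> runs on
  through the pairs. At its end tapes \<open>3\<close> and \<open>4\<close> return to the start of
  the unary \<open>n\<close>.\<close>

definition write_matrix :: prog where
  "write_matrix =
     While (\<lambda>rs. rs ! 1 \<noteq> None) (
       While (\<lambda>rs. rs ! 3 \<noteq> None) write_row ;;
       move [Stay, Stay, Stay, Left, Stay] ;;
       While (\<lambda>rs. rs ! 3 \<noteq> None) (move [Stay, Stay, Stay, Left, Stay]) ;;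
       move [Stay, Stay, Stay, Right, Stay] ;;
       While (\<lambda>rs. rs ! 4 = None) (move [Stay, Stay, Stay, Stay, Right]))"

text \<open>The final tape has to equal \<open>tape_of y\<close>, which includes the head being on
  the first symbol.\<close>

definition rewind_output :: prog where
  "rewind_output =
     move [Left, Stay, Stay, Stay, Stay] ;;
     While (\<lambda>rs. rs ! 0 \<noteq> None) (move [Left, Stay, Stay, Stay, Stay]) ;;
     move [Right, Stay, Stay, Stay, Stay]"

definition arc_prog :: prog where
  "arc_prog = copy_input ;; write_header ;; write_matrix ;; rewind_output"

lemma prog_arity_arc_prog: "prog_arity 5 arc_prog"
  by (simp add: arc_prog_def copy_input_def write_header_def write_row_def write_matrix_def
      rewind_output_def move_def)

abbreviation write_at_end :: "bool list \<Rightarrow> tape" where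
  "write_at_end w \<equiv> tape_at w (int (length w))"

text \<open>Row \<open>p\<close> of the adjacency matrix of the arc digraph, if \<open>A\<close>
  lists that of the digraph row by row: both codes stand for arcs, and the second arc starts where
  the first one ends.\<close>

definition row_bits :: "nat \<Rightarrow> bool list \<Rightarrow> nat \<Rightarrow> bool list" where
  "row_bits n A p = map (\<lambda>j. A ! p \<and> A ! j \<and> j div n = p mod n) [0..<length A]"

section \<open>Correctness and running time of the program\<close>

context
  fixes n m :: nat and A x :: "bool list"
  assumes A: "length A = m"
  defines "x \<equiv> replicate n True @ False # A"
begin

lemma length_x: "length x = n + 1 + m"
  by (simp add: x_def A)

lemma read_unary: "k < n \<Longrightarrow> tape_at x (int k) 0 = Some True"
  by (simp add: read_tape_at length_x, simp add: x_def nth_append)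

lemma read_separator: "tape_at x (int n) 0 = Some False"
  by (simp add: read_tape_at length_x, simp add: x_def nth_append)

lemma read_entry: "j < m \<Longrightarrow> tape_at x (int n + 1 + int j) 0 = Some (A ! j)"
proof -
  assume "j < m"
  have "nat (int n + 1 + int j) = Suc (n + j)" by simp
  then show ?thesis
    using \<open>j < m\<close> by (simp add: read_tape_at length_x, simp add: x_def nth_append)
qed

lemma read_end: "tape_at x (int n + 1 + int m) 0 = None"
  by (simp add: read_tape_at length_x)

lemma take_x: "take n x = replicate n True"
  by (simp add: x_def)

lemma runs_copy_input:
  "runs copy_input (10 * (n + m) + 20)
     [tape_of x, tape_of [], tape_of [], tape_of [], tape_of []]
     [tape_of [], tape_at x 0, tape_at x 0, tape_at (replicate n True) 0, tape_at (replicate n True) 0]"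
proof -
  let ?u = "tape_at (replicate n True)"
  let ?L = "n + 1 + m"
  let ?S1 = "\<lambda>k. [tape_at x (int k), tape_at (take k x) (int k), tape_at (take k x) (int k),
     tape_at (take k x) (int k), tape_at (take k x) (int k)]"
  have 1: "runs (While (\<lambda>rs. rs ! 0 = Some True) (Act (\<lambda>rs. replicate 5 (rs ! 0, Right))))
     (n * Suc 1 + 1) (?S1 0) (?S1 n)"
    by (rule runs_While, simp add: read_unary, rule runs_Act)
      (simp_all add: numeral_eq_Suc act_move act_copy length_x read_separator algebra_simps)
  \<comment> \<open>From here on \<open>k\<close> counts symbols behind the unary prefix. The loop
    makes \<open>Suc m\<close> rounds because the separator is copied too.\<close>
  let ?S2 = "\<lambda>k. [tape_at x (int (n + k)), tape_at (take (n + k) x) (int (n + k)),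
     tape_at (take (n + k) x) (int (n + k)), ?u (int n), ?u (int n)]"
  have 2: "runs (While (\<lambda>rs. rs ! 0 \<noteq> None) (Act (\<lambda>rs.
       [(rs ! 0, Right), (rs ! 0, Right), (rs ! 0, Right), (rs ! 3, Stay), (rs ! 4, Stay)])))
     (Suc m * Suc 1 + 1) (?S2 0) (?S2 (Suc m))"
  proof (rule runs_While)
    fix i assume "i < Suc m"
    then have "n + i < length x" by (simp add: length_x)
    from act_copy[OF this, of Right]
    show "runs (Act (\<lambda>rs.
       [(rs ! 0, Right), (rs ! 0, Right), (rs ! 0, Right), (rs ! 3, Stay), (rs ! 4, Stay)])) 1
       (?S2 i) (?S2 (Suc i))"
      by (intro runs_Act) (simp add: act_move algebra_simps)
  qed (simp_all add: read_tape_at length_x)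
  \<comment> \<open>\<open>?L\<close> is the length of \<open>x\<close>. Tape \<open>0\<close> is
    erased from the right while tapes \<open>1\<close> and \<open>2\<close> retreat in step with it,
    so all three reach position \<open>- 1\<close> together.\<close>
  let ?S3 = "\<lambda>k. [tape_at (take (?L - k) x) (int ?L - 1 - int k), tape_at x (int ?L - 1 - int k),
     tape_at x (int ?L - 1 - int k), ?u (int n - 1), ?u (int n - 1)]"
  have 3: "runs (move [Left, Left, Left, Left, Left]) 1 (?S2 (Suc m)) (?S3 0)"
    by (rule runs_move) (simp_all add: shift_tape_at length_x)
  have 4: "runs (While (\<lambda>rs. rs ! 1 \<noteq> None) (Act (\<lambda>rs.
       [(None, Left), (rs ! 1, Left), (rs ! 2, Left), (rs ! 3, Stay), (rs ! 4, Stay)])))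
     (?L * Suc 1 + 1) (?S3 0) (?S3 ?L)"
  proof (rule runs_While)
    fix i assume i: "i < ?L"
    let ?k = "?L - Suc i"
    have k: "?L - i = Suc ?k" "int ?L - 1 - int i = int ?k" "int ?L - 1 - int (Suc i) = int ?k - 1"
      "?k < length x"
      using i by (auto simp: length_x)
    show "runs (Act (\<lambda>rs.
       [(None, Left), (rs ! 1, Left), (rs ! 2, Left), (rs ! 3, Stay), (rs ! 4, Stay)])) 1
       (?S3 i) (?S3 (Suc i))"
      unfolding k(1-3) using act_erase[OF k(4), of Left] by (intro runs_Act) (simp add: act_move)
  qed (simp_all add: read_tape_at length_x)
  let ?S4 = "[tape_of [], tape_at x (- 1), tape_at x (- 1), ?u (- 1), ?u (- 1)]"
  have 5: "runs (While (\<lambda>rs. rs ! 3 \<noteq> None) (move [Stay, Stay, Stay, Left, Left])) (2 * n + 1)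
     (?S3 ?L) ?S4"
    by (rule runs_While_move)
      (simp_all add: shift_tape_at shift_blank tape_at_Nil read_tape_at)
  have 6: "runs (move [Stay, Right, Right, Right, Right]) 1 ?S4
     [tape_of [], tape_at x 0, tape_at x 0, ?u 0, ?u 0]"
    by (rule runs_move) (simp_all add: shift_tape_at shift_blank)
  have S: "?S1 0 = [tape_of x, tape_of [], tape_of [], tape_of [], tape_of []]" "?S1 n = ?S2 0"
    by (simp_all add: tape_at_0 take_x)
  show ?thesis
    unfolding copy_input_def
    by (rule runs_mono[OF runs_Seq[OF 1[unfolded S] runs_Seq[OF 2 runs_Seq[OF 3 runs_Seq[OF 4
            runs_Seq[OF 5 6]]]]]]) simp
qed

lemma runs_write_header:
  "runs write_header (10 * (n + m) + 20)
     [tape_of [], tape_at x 0, tape_at x 0, T, T']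
     [tape_at (replicate m True @ [False]) (int m + 1), tape_at x (int n + 1), tape_at x 0, T, T']"
proof -
  let ?o = "\<lambda>k. tape_at (replicate k True) (int k)"
  let ?o' = "tape_at (replicate m True @ [False]) (int m + 1)"
  note stay = shift_def[of 0] act_Stay
  have 1: "runs (While (\<lambda>rs. rs ! 2 = Some True) (move [Stay, Stay, Right, Stay, Stay])) (2 * n + 1)
     [tape_of [], tape_at x 0, tape_at x 0, T, T'] [?o 0, tape_at x 0, tape_at x (int n), T, T']"
    by (rule runs_While_move)
      (simp_all add: shift_tape_at stay tape_at_Nil read_unary read_separator)
  let ?S = "\<lambda>j. [?o j, tape_at x 0, tape_at x (int n + 1 + int j), T, T']"
  have 2: "runs (move [Stay, Stay, Right, Stay, Stay]) 1
     [?o 0, tape_at x 0, tape_at x (int n), T, T'] (?S 0)"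
    by (rule runs_move) (simp_all add: shift_tape_at stay)
  have 3: "runs (While (\<lambda>rs. rs ! 2 \<noteq> None) (Act (\<lambda>rs.
       [(Some True, Right), (rs ! 1, Stay), (rs ! 2, Right), (rs ! 3, Stay), (rs ! 4, Stay)])))
     (m * Suc 1 + 1) (?S 0) (?S m)"
  proof (rule runs_While)
    fix i assume "i < m"
    show "runs (Act (\<lambda>rs.
       [(Some True, Right), (rs ! 1, Stay), (rs ! 2, Right), (rs ! 3, Stay), (rs ! 4, Stay)])) 1
       (?S i) (?S (Suc i))"
      using act_append[of True Right "replicate i True"]
      by (intro runs_Act) (simp add: act_move stay replicate_append_same algebra_simps)
  qed (simp_all add: read_entry read_end)
  \<comment> \<open>The step to the left takes tape \<open>2\<close> from the blank behind
    \<open>x\<close> to its last symbol, so that the rewinding loop starts on a nonblank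
    cell.\<close>
  have 4: "runs (Act (\<lambda>rs.
       [(Some False, Right), (rs ! 1, Stay), (rs ! 2, Left), (rs ! 3, Stay), (rs ! 4, Stay)])) 1
     (?S m) [?o', tape_at x 0, tape_at x (int (n + m)), T, T']"
    using act_append[of False Right "replicate m True"]
    by (intro runs_Act) (simp add: act_move stay algebra_simps)
  have 5: "runs (While (\<lambda>rs. rs ! 2 \<noteq> None) (move [Stay, Stay, Left, Stay, Stay]))
     (2 * (n + m + 1) + 1) [?o', tape_at x 0, tape_at x (int (n + m)), T, T']
     [?o', tape_at x 0, tape_at x (- 1), T, T']"
    by (rule runs_While_move) (simp_all add: shift_tape_at stay read_tape_at length_x)
  have 6: "runs (move [Stay, Stay, Right, Stay, Stay]) 1
     [?o', tape_at x 0, tape_at x (- 1), T, T'] [?o', tape_at x 0, tape_at x 0, T, T']"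
    by (rule runs_move) (simp_all add: shift_tape_at stay)
  have 7: "runs (While (\<lambda>rs. rs ! 1 = Some True) (move [Stay, Right, Stay, Stay, Stay])) (2 * n + 1)
     [?o', tape_at x 0, tape_at x 0, T, T'] [?o', tape_at x (int n), tape_at x 0, T, T']"
    by (rule runs_While_move)
      (simp_all add: shift_tape_at stay read_unary read_separator)
  have 8: "runs (move [Stay, Right, Stay, Stay, Stay]) 1
     [?o', tape_at x (int n), tape_at x 0, T, T'] [?o', tape_at x (int n + 1), tape_at x 0, T, T']"
    by (rule runs_move) (simp_all add: shift_tape_at stay)
  show ?thesis
    unfolding write_header_def
    by (rule runs_mono[OF runs_Seq[OF 1 runs_Seq[OF 2 runs_Seq[OF 3 runs_Seq[OF 4
            runs_Seq[OF 5 runs_Seq[OF 6 runs_Seq[OF 7 8]]]]]]]]) simp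
qed

lemma runs_write_row:
  assumes p: "p < m" and v: "v < n" "p mod n = v"
  shows "runs write_row (10 * (n + m) + 20)
     [write_at_end w, tape_at x (int n + 1 + int p), tape_at x 0, tape_at u (int v),
      tape_at (replicate n True) (- int (v * n))]
     [write_at_end (w @ row_bits n A p), tape_at x (int n + 1 + int (Suc p)), tape_at x 0,
      tape_at u (int (Suc v)), tape_at (replicate n True) (- int (Suc v * n))]"
proof -
  let ?b = "tape_at x (int n + 1 + int p)" and ?d = "tape_at u (int v)"
    and ?e = "tape_at (replicate n True)"
  define z where "z = - int (v * n)"
  define bit where "bit j \<longleftrightarrow> A ! p \<and> A ! j \<and> j div n = p mod n" for j
  let ?o = "\<lambda>j. write_at_end (w @ map bit [0..<j])"
  have 1: "runs (While (\<lambda>rs. rs ! 2 = Some True) (move [Stay, Stay, Right, Stay, Stay])) (2 * n + 1)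
     [write_at_end w, ?b, tape_at x 0, ?d, ?e z] [?o 0, ?b, tape_at x (int n), ?d, ?e z]"
    by (rule runs_While_move)
      (simp_all add: shift_tape_at read_unary read_separator)
  let ?S = "\<lambda>j. [?o j, ?b, tape_at x (int n + 1 + int j), ?d, ?e (z + int j)]"
  have 2: "runs (move [Stay, Stay, Right, Stay, Stay]) 1
     [?o 0, ?b, tape_at x (int n), ?d, ?e z] (?S 0)"
    by (rule runs_move) (simp_all add: shift_tape_at)
  let ?w = "Act (\<lambda>rs.
       [(Some (rs ! 1 = Some True \<and> rs ! 2 = Some True \<and> rs ! 4 \<noteq> None), Right),
        (rs ! 1, Stay), (rs ! 2, Right), (rs ! 3, Stay), (rs ! 4, Right)])"
  have 3: "runs (While (\<lambda>rs. rs ! 2 \<noteq> None) ?w) (m * Suc 1 + 1) (?S 0) (?S m)"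
  proof (rule runs_While)
    fix j assume j: "j < m"
    define c where "c = v * n"
    \<comment> \<open>In column \<open>j\<close> tape \<open>4\<close> is at position
      \<open>j - v * n\<close>, hence nonblank exactly on the \<open>n\<close> columns that code
      pairs \<open>(v, w)\<close>.\<close>
    have "?e (z + int j) 0 \<noteq> None \<longleftrightarrow> v * n \<le> j \<and> j < v * n + n"
      unfolding z_def read_tape_at c_def[symmetric] by auto
    also have "\<dots> \<longleftrightarrow> j div n = v"
      using v(1) by (metis add.commute div_nat_eqI dividend_less_div_times gr_zeroI less_nat_zero_code
          mult.commute mult_Suc times_div_less_eq_dividend)
    finally have bit: "bit j \<longleftrightarrow> ?b 0 = Some True \<and> tape_at x (int n + 1 + int j) 0 = Some True
        \<and> ?e (z + int j) 0 \<noteq> None"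
      using p j v by (auto simp: bit_def read_entry)
    show "runs ?w 1 (?S j) (?S (Suc j))"
      using act_append[of "bit j" Right "w @ map bit [0..<j]"] unfolding bit
      by (intro runs_Act) (simp add: act_move algebra_simps bit)
  qed (simp_all add: read_entry read_end)
  have 4: "runs (move [Stay, Stay, Left, Stay, Stay]) 1 (?S m)
     [?o m, ?b, tape_at x (int (n + m)), ?d, ?e (z + int m)]"
    by (rule runs_move) (simp_all add: shift_tape_at)
  \<comment> \<open>Tape \<open>2\<close> passes all \<open>n + m + 1\<close> symbols of
    \<open>x\<close>, which takes tape \<open>4\<close> from \<open>z + m\<close> to
    \<open>z - n - 1\<close>; the next move to the right makes this \<open>z - n\<close>.\<close>
  have 5: "runs (While (\<lambda>rs. rs ! 2 \<noteq> None) (move [Stay, Stay, Left, Stay, Left]))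
     (2 * (n + m + 1) + 1) [?o m, ?b, tape_at x (int (n + m)), ?d, ?e (z + int m)]
     [?o m, ?b, tape_at x (- 1), ?d, ?e (z + (- int n - 1))]"
    by (rule runs_While_move) (simp_all add: shift_tape_at read_tape_at length_x)
  have 6: "runs (move [Stay, Right, Right, Right, Right]) 1
     [?o m, ?b, tape_at x (- 1), ?d, ?e (z + (- int n - 1))]
     [?o m, tape_at x (int n + 1 + int (Suc p)), tape_at x 0, tape_at u (int (Suc v)), ?e (z - int n)]"
    by (rule runs_move) (simp_all add: shift_tape_at algebra_simps)
  have "row_bits n A p = map bit [0..<m]" "- int (Suc v * n) = z - int n"
    by (simp_all add: row_bits_def A bit_def z_def)
  note eqs = this z_def[symmetric]
  show ?thesis
    unfolding write_row_def eqs
    by (rule runs_mono[OF runs_Seq[OF 1 runs_Seq[OF 2 runs_Seq[OF 3 runs_Seq[OF 4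
            runs_Seq[OF 5 6]]]]]]) simp
qed

lemma runs_write_matrix:
  assumes m: "m = n * n"
  shows "runs write_matrix (n * Suc (n * (10 * (n + m) + 30) + 10 * (n + m) + 29) + 1)
     [write_at_end w, tape_at x (int n + 1), tape_at x 0, tape_at (replicate n True) 0,
      tape_at (replicate n True) 0]
     [write_at_end (w @ concat (map (row_bits n A) [0..<m])), tape_at x (int n + 1 + int m), tape_at x 0,
      tape_at (replicate n True) 0, tape_at (replicate n True) 0]"
proof -
  let ?u = "tape_at (replicate n True)"
  let ?o = "\<lambda>p. write_at_end (w @ concat (map (row_bits n A) [0..<p]))"
  let ?S = "\<lambda>k. [?o (k * n), tape_at x (int n + 1 + int (k * n)), tape_at x 0, ?u 0, ?u 0]"
  let ?body = "While (\<lambda>rs. rs ! 3 \<noteq> None) write_row ;;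
       move [Stay, Stay, Stay, Left, Stay] ;;
       While (\<lambda>rs. rs ! 3 \<noteq> None) (move [Stay, Stay, Stay, Left, Stay]) ;;
       move [Stay, Stay, Stay, Right, Stay] ;;
       While (\<lambda>rs. rs ! 4 = None) (move [Stay, Stay, Stay, Stay, Right])"
  have "runs (While (\<lambda>rs. rs ! 1 \<noteq> None) ?body)
     (n * Suc (n * (10 * (n + m) + 30) + 10 * (n + m) + 29) + 1) (?S 0) (?S n)"
  proof (rule runs_While)
    fix k assume k: "k < n"
    then have km: "k * n + n \<le> m"
      using mult_le_mono1[of "Suc k" n n] by (simp add: m)
    let ?R = "\<lambda>v. [?o (k * n + v), tape_at x (int n + 1 + int (k * n + v)), tape_at x 0,
      ?u (int v), ?u (- int (v * n))]"
    have 1: "runs (While (\<lambda>rs. rs ! 3 \<noteq> None) write_row) (n * Suc (10 * (n + m) + 20) + 1)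
      (?R 0) (?R n)"
    proof (rule runs_While)
      fix v assume v: "v < n"
      then have "k * n + v < m" "(k * n + v) mod n = v"
        using km by auto
      from runs_write_row[OF this(1) v this(2),
          where w = "w @ concat (map (row_bits n A) [0..<k * n + v])" and u = "replicate n True"]
      show "runs write_row (10 * (n + m) + 20) (?R v) (?R (Suc v))"
        by simp
    qed (simp_all add: read_tape_at)
    let ?b = "tape_at x (int n + 1 + int (k * n + n))"
    let ?z = "- int m"
    have 2: "runs (move [Stay, Stay, Stay, Left, Stay]) 1 (?R n)
      [?o (k * n + n), ?b, tape_at x 0, ?u (int n - 1), ?u ?z]"
      by (rule runs_move) (simp_all add: shift_tape_at m)
    have 3: "runs (While (\<lambda>rs. rs ! 3 \<noteq> None) (move [Stay, Stay, Stay, Left, Stay])) (2 * n + 1)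
      [?o (k * n + n), ?b, tape_at x 0, ?u (int n - 1), ?u ?z]
      [?o (k * n + n), ?b, tape_at x 0, ?u (- 1), ?u ?z]"
      by (rule runs_While_move) (simp_all add: shift_tape_at read_tape_at)
    have 4: "runs (move [Stay, Stay, Stay, Right, Stay]) 1
      [?o (k * n + n), ?b, tape_at x 0, ?u (- 1), ?u ?z] [?o (k * n + n), ?b, tape_at x 0, ?u 0, ?u ?z]"
      by (rule runs_move) (simp_all add: shift_tape_at)
    \<comment> \<open>After \<open>n\<close> rows tape \<open>4\<close> is at
      \<open>- (n * n) = - m\<close>. Moving right by \<open>m\<close> cells reaches its first
      symbol, which exists because \<open>k < n\<close>.\<close>
    have 5: "runs (While (\<lambda>rs. rs ! 4 = None) (move [Stay, Stay, Stay, Stay, Right])) (2 * m + 1)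
      [?o (k * n + n), ?b, tape_at x 0, ?u 0, ?u ?z] [?o (k * n + n), ?b, tape_at x 0, ?u 0, ?u 0]"
      using k by (intro runs_While_move) (simp_all add: shift_tape_at read_tape_at)
    have "?R 0 = ?S k" "[?o (k * n + n), ?b, tape_at x 0, ?u 0, ?u 0] = ?S (Suc k)"
      by (simp_all add: add.commute)
    with runs_Seq[OF 1 runs_Seq[OF 2 runs_Seq[OF 3 runs_Seq[OF 4 5]]]]
    have "runs ?body (n * Suc (10 * (n + m) + 20) + 1 + (1 + (2 * n + 1 + (1 + (2 * m + 1)))))
      (?S k) (?S (Suc k))"
      by (simp only:)
    then show "runs ?body (n * (10 * (n + m) + 30) + 10 * (n + m) + 29) (?S k) (?S (Suc k))"
      by (rule runs_mono) (simp add: algebra_simps)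
    have "k * n < m" using km k by simp
    then show "(scan (?S k)) ! 1 \<noteq> None"
      by (simp add: read_entry del: of_nat_mult)
  qed (use read_end m in simp)
  then show ?thesis
    unfolding write_matrix_def by (simp add: m)
qed

lemma runs_rewind_output:
  "runs rewind_output (2 * length y + 3) [write_at_end y, T1, T2, T3, T4] [tape_of y, T1, T2, T3, T4]"
proof -
  have 1: "runs (move [Left, Stay, Stay, Stay, Stay]) 1 [write_at_end y, T1, T2, T3, T4]
     [tape_at y (int (length y) - 1), T1, T2, T3, T4]"
    by (rule runs_move) (simp_all add: shift_tape_at shift_def[of 0])
  have 2: "runs (While (\<lambda>rs. rs ! 0 \<noteq> None) (move [Left, Stay, Stay, Stay, Stay])) (2 * length y + 1)
     [tape_at y (int (length y) - 1), T1, T2, T3, T4] [tape_at y (- 1), T1, T2, T3, T4]"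
    by (rule runs_While_move) (simp_all add: shift_tape_at shift_def[of 0] read_tape_at)
  have 3: "runs (move [Right, Stay, Stay, Stay, Stay]) 1
     [tape_at y (- 1), T1, T2, T3, T4] [tape_of y, T1, T2, T3, T4]"
    by (rule runs_move) (simp_all add: shift_tape_at shift_def[of 0] tape_at_0)
  show ?thesis
    unfolding rewind_output_def
    by (rule runs_mono[OF runs_Seq[OF 1 runs_Seq[OF 2 3]]]) simp
qed

lemma runs_arc_prog:
  assumes m: "m = n * n"
  shows "\<exists>Ts. runs arc_prog (poly [:46, 52, 42, 10:] (length x))
     [tape_of x, tape_of [], tape_of [], tape_of [], tape_of []]
     (tape_of (replicate m True @ False # concat (map (row_bits n A) [0..<m])) # Ts)"
proof -
  let ?w = "replicate m True @ [False]"
  let ?y = "?w @ concat (map (row_bits n A) [0..<m])"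
  have o: "tape_at ?w (int m + 1) = write_at_end ?w"
    by (simp add: add.commute)
  have "length (row_bits n A p) = m" for p
    by (simp add: row_bits_def A)
  then have y: "length ?y = m + 1 + m * m"
    by (simp add: length_concat comp_def sum_list_triv)
  note 1 = runs_Seq[OF runs_copy_input runs_Seq[OF runs_write_header[unfolded o]
        runs_Seq[OF runs_write_matrix[OF m] runs_rewind_output]], folded arc_prog_def]
  \<comment> \<open>The coefficients result from replacing \<open>n\<close>, \<open>m\<close> and
    \<open>n + m\<close> by the length of \<open>x\<close> and expanding.\<close>
  have "10 * (n + m) + 20 + (10 * (n + m) + 20 +
      (n * Suc (n * (10 * (n + m) + 30) + 10 * (n + m) + 29) + 1 + (2 * length ?y + 3)))
    \<le> poly [:46, 52, 42, 10:] (length x)"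
  proof -
    let ?l = "length x"
    have le: "n \<le> ?l" "m \<le> ?l" "n + m \<le> ?l"
      by (simp_all add: length_x)
    have "10 * (n + m) + 20 + (10 * (n + m) + 20 +
        (n * Suc (n * (10 * (n + m) + 30) + 10 * (n + m) + 29) + 1 + (2 * (m + 1 + m * m) + 3)))
      \<le> 10 * ?l + 20 + (10 * ?l + 20 +
        (?l * Suc (?l * (10 * ?l + 30) + 10 * ?l + 29) + 1 + (2 * (?l + 1 + ?l * ?l) + 3)))"
      using le by (intro add_mono mult_le_mono Suc_le_mono[THEN iffD2] order_refl)
    also have "\<dots> = poly [:46, 52, 42, 10:] ?l"
      by (simp add: algebra_simps)
    finally show ?thesis
      unfolding y .
  qed
  from runs_mono[OF 1 this] show ?thesis
    by auto
qed

end

section \<open>Encodings as lists indexed by coded pairs\<close>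

lemma concat_map_upt:
  fixes n :: nat
  shows "concat (map (\<lambda>u. map (f u) [0..<n]) [0..<k]) = map (\<lambda>p. f (p div n) (p mod n)) [0..<k * n]"
proof (induction k)
  case (Suc k)
  have "map (f k) [0..<n] = map (\<lambda>p. f (p div n) (p mod n)) [k * n..<k * n + n]"
    by (rule nth_equalityI) (simp_all add: add.commute)
  moreover have "[0..<Suc k * n] = [0..<k * n] @ [k * n..<k * n + n]"
    by (metis add.commute le0 mult_Suc upt_add_eq_append)
  ultimately show ?case
    using Suc by (simp del: mult_Suc)
qed simp

lemma encode_alt:
  "encode I = (let n = card (pverts I) in replicate n True @ False #
     map (\<lambda>p. (p div n, p mod n) \<in> parcs I) [0..<n * n])"
  unfolding encode_def Let_def concat_map_upt[where f = "\<lambda>u v. (u, v) \<in> parcs I"] by simp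

text \<open>Identifies the word left by \<open>arc_prog\<close> as the encoding of the arc
  digraph.\<close>

lemma encode_arc_digraph:
  fixes I
  defines "n \<equiv> card (pverts I)"
  defines "A \<equiv> map (\<lambda>p. (p div n, p mod n) \<in> parcs I) [0..<n * n]"
  shows "encode (arc_digraph I) = replicate (n * n) True @ False #
    concat (map (row_bits n A) [0..<n * n])"
proof -
  have "row_bits n A p = map (\<lambda>q. (p, q) \<in> parcs (arc_digraph I)) [0..<n * n]"
    if "p < n * n" for p
    using that by (auto simp: row_bits_def A_def arc_digraph_def Let_def simp flip: n_def)
  then have "map (row_bits n A) [0..<n * n]
    = map (\<lambda>p. map (\<lambda>q. (p, q) \<in> parcs (arc_digraph I)) [0..<n * n]) [0..<n * n]"
    by simp
  then show ?thesis
    by (simp only: encode_def Let_def arc_digraph_verts card_lessThan append_Cons append_Nil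
        flip: n_def)
qed

text \<open>The digraph is a function of the input word, so that the statement can be iterated and
  starts from any reduction whose values are encodings.\<close>

theorem polytime_computable_arc_digraph:
  assumes "polytime_computable (\<lambda>x. encode (I x))"
  shows "polytime_computable (\<lambda>x. encode (arc_digraph (I x)))"
proof (rule polytime_computable_comp[OF assms])
  show "is_tm (prog_tm 5 arc_prog)"
    using prog_arity_arc_prog by (intro is_tm_prog) auto
  fix x
  let ?n = "card (pverts (I x))"
  let ?A = "map (\<lambda>p. (p div ?n, p mod ?n) \<in> parcs (I x)) [0..<?n * ?n]"
  have "length ?A = ?n * ?n" by simp
  from runs_arc_prog[OF this refl] obtain Ts where
    "runs arc_prog (poly [:46, 52, 42, 10:] (length (encode (I x))))
       [tape_of (encode (I x)), tape_of [], tape_of [], tape_of [], tape_of []]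
       (tape_of (encode (arc_digraph (I x))) # Ts)"
    unfolding encode_arc_digraph[of "I x"] encode_alt[of "I x", unfolded Let_def] by blast
  then show "outputs_within (prog_tm 5 arc_prog) [encode (I x)]
      (poly [:46, 52, 42, 10:] (length (encode (I x)))) (encode (arc_digraph (I x)))"
    by (intro prog_tm_outputs[OF prog_arity_arc_prog]) (simp_all add: numeral_eq_Suc)
qed

lemma polytime_computable_iterated_arc_digraph:
  assumes "polytime_computable (\<lambda>x. encode (I x))"
  shows "polytime_computable (\<lambda>x. encode ((arc_digraph ^^ i) (I x)))"
proof (induction i)
  case (Suc i)
  then show ?case
    using polytime_computable_arc_digraph by simp
qed (use assms in simp)

section \<open>The reduction by iterated arc digraphs\<close>

theorem theorem4p17:
  fixes H :: "'h pair_pre_digraph"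
  assumes "pair_digraph H"
    and "\<And>G :: nat pair_pre_digraph. pair_digraph G \<Longrightarrow> H \<rightarrow>\<^sub>h G \<Longrightarrow> NP_hard (PCSP H G)"
  shows "\<forall>G :: 'g pair_pre_digraph. pair_digraph G \<longrightarrow> K3 \<rightarrow>\<^sub>h G \<longrightarrow> NP_hard (PCSP K3 G)"
proof (intro allI impI)
  fix G :: "'g pair_pre_digraph"
  assume G: "pair_digraph G"
  define m where "m = card (pverts H)"
  obtain K where K: "\<And>I. instance_digraph I \<Longrightarrow>
      (arc_digraph ^^ (2 * m)) I \<rightarrow>\<^sub>h complete_digraph (card (pverts G)) \<Longrightarrow> I \<rightarrow>\<^sub>h complete_digraph K"
    using iterated_arc_digraph_colouring_lift by blast
  \<comment> \<open>At least \<open>m\<close> colours give a homomorphism from \<open>H\<close>, and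
    at least \<open>K\<close> colours make NO-instances go to NO-instances.\<close>
  let ?G' = "complete_digraph (max m K)"
  have "H \<rightarrow>\<^sub>h complete_digraph m"
    using hom_to_complete_digraph[OF assms(1)] by (simp add: m_def)
  \<comment> \<open>With \<open>3 + m\<close> colours, exactly \<open>m\<close> double applications
    lead to three colours, even if \<open>H\<close> has fewer than three vertices.\<close>
  then have H: "H \<rightarrow>\<^sub>h complete_digraph (3 + m)" "H \<rightarrow>\<^sub>h ?G'"
    using complete_digraph_mono hom_to_trans by (metis le_add2, metis max.cobounded1)
  have yes: "(arc_digraph ^^ (2 * m)) I \<rightarrow>\<^sub>h K3" if "instance_digraph I" "I \<rightarrow>\<^sub>h H" for I
    using that H(1) hom_to_trans iterated_arc_digraph_3_colouring by blast
  have no: "\<not> (arc_digraph ^^ (2 * m)) I \<rightarrow>\<^sub>h G" if "instance_digraph I" "\<not> I \<rightarrow>\<^sub>h ?G'" for I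
    using that K hom_to_complete_digraph[OF G] hom_to_trans complete_digraph_mono
    by (metis max.cobounded2)
  show "NP_hard (PCSP K3 G)"
    unfolding NP_hard_def
  proof (intro allI impI)
    fix L assume "in_NP L"
    then have "reduces_to L (PCSP H ?G')"
      using assms(2)[OF pair_digraph_complete_digraph H(2)] by (simp add: NP_hard_def)
    then obtain f where f: "polytime_computable f"
      and red: "\<And>x. x \<in> L \<Longrightarrow> f x \<in> fst (PCSP H ?G')" "\<And>x. x \<notin> L \<Longrightarrow> f x \<in> snd (PCSP H ?G')"
      unfolding reduces_to_def by blast
    \<comment> \<open>Every value of \<open>f\<close> encodes an instance that witnesses its side of
      the promise. Choosing one for each word turns \<open>f\<close> into a map to digraphs.\<close>
    have "\<exists>I. instance_digraph I \<and> f x = encode I \<and> (x \<in> L \<longrightarrow> I \<rightarrow>\<^sub>h H) \<and> (x \<notin> L \<longrightarrow> \<not> I \<rightarrow>\<^sub>h ?G')" for x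
      using red[of x] by (cases "x \<in> L") (auto simp: PCSP_def)
    then obtain I where I: "\<And>x. instance_digraph (I x)" "\<And>x. f x = encode (I x)"
      "\<And>x. x \<in> L \<Longrightarrow> I x \<rightarrow>\<^sub>h H" "\<And>x. x \<notin> L \<Longrightarrow> \<not> I x \<rightarrow>\<^sub>h ?G'"
      by metis
    have "f = (\<lambda>x. encode (I x))"
      using I(2) by blast
    then have "polytime_computable (\<lambda>x. encode ((arc_digraph ^^ (2 * m)) (I x)))"
      using f polytime_computable_iterated_arc_digraph by blast
    moreover have "encode ((arc_digraph ^^ (2 * m)) (I x)) \<in> fst (PCSP K3 G)" if "x \<in> L" for x
      using yes I(1,3) that instance_arc_digraph_iterate by (fastforce simp: PCSP_def)
    moreover have "encode ((arc_digraph ^^ (2 * m)) (I x)) \<in> snd (PCSP K3 G)" if "x \<notin> L" for x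
      using no I(1,4) that instance_arc_digraph_iterate by (fastforce simp: PCSP_def)
    ultimately show "reduces_to L (PCSP K3 G)"
      unfolding reduces_to_def by blast
  qed
qed

end
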